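(* Let $k\ge 1$, let $s\in\mathbb{C}$, $\epsilon\in\{\pm1\}$, and let $f:\mathbb{R}^k\setminus\{0\}\to\mathbb{C}$ be a $C^\infty$ function homogeneous of type $(-s,\epsilon)$. Let $D=\mathbb{R}^k\setminus(\mathbb{Z}^k\setminus\{0\})=(\mathbb{R}^k\setminus\mathbb{Z}^k)\cup\{0\}$, and let $1=(1,\dots,1)\in\mathbb{T}^k$. Then for every $x\in D$ and every $z\in\mathbb{T}^k\setminus\{1\}$ the series $$F_f(x,z)=\sum_{0\neq n\in\mathbb{Z}^k}f(x+n)z^n$$ is t-summable. Furthermore the sum of this series gives a $C^\infty$ function $F_f$ on the domain $D\times(\mathbb{T}^k\setminus\{1\})$.
   Context: Notation: $\mathbb{T}=\{z\in\mathbb{C}:|z|=1\}$; for $n\in\mathbb{Z}^k$ and $z\in\mathbb{T}^k$, $z^n=z_1^{n_1}\cdots z_k^{n_k}$. Homogeneity: $f:\mathbb{R}^k\setminus\{0\}\to\mathbb{C}$ is homogeneous of type $(\sigma,\epsilon)\in\mathbb{C}\times\{\pm1\}$ if $f(tx)=t^{\sigma}f(x)$ and $f(-x)=\epsilon f(x)$ for all $t>0$ and $0\ne x\in\mathbb{R}^k$. t-summability: let $\Gamma$ be a (discrete) abelian group, written additively. For $c:\Gamma\to\mathbb{C}$ finitely supported and $a:\Gamma\to\mathbb{C}$ arbitrary, $(c*a)(\gamma)=\sum_{\gamma'}c(\gamma')a(\gamma-\gamma')$. The function $a$ (or the series $\sum_{\gamma\in\Gamma}a(\gamma)$) is t-summable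 if there is a finitely supported $c:\Gamma\to\mathbb{C}$ with $\sum_\gamma c(\gamma)\neq0$ and $\sum_\gamma|(c*a)(\gamma)|<\infty$; its sum is then defined as $\big(\sum_\gamma c(\gamma)\big)^{-1}\sum_\gamma (c*a)(\gamma)$, which is independent of the choice of $c$. If $a$ is defined only on a subset $M\subset\Gamma$, the series $\sum_{\gamma\in M}a(\gamma)$ is called t-summable when the extension of $a$ by zero to $\Gamma$ is t-summable. Here $\Gamma=\mathbb{Z}^k$. *)

theory Defs
  imports "HOL-Analysis.Analysis"
begin

section \<open>Smooth functions\<close>

text \<open>Meant for open \<open>S\<close>: the iterated directional derivatives up to order \<open>n\<close> exist on \<open>S\<close>,
  every one of order less than \<open>n\<close> is Frechet differentiable there, and those of order \<open>n\<close>
  are continuous. Only the values of \<open>f\<close> on the open set \<open>S\<close> matter.\<close>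

fun C_k_on :: "nat \<Rightarrow> 'a::euclidean_space set \<Rightarrow> ('a \<Rightarrow> 'b::real_normed_vector) \<Rightarrow> bool" where
  "C_k_on 0 S f \<longleftrightarrow> continuous_on S f"
| "C_k_on (Suc n) S f \<longleftrightarrow>
     (\<forall>x\<in>S. f differentiable (at x)) \<and>
     (\<forall>v. C_k_on n S (\<lambda>x. frechet_derivative f (at x) v))"

definition smooth_on :: "'a::euclidean_space set \<Rightarrow> ('a \<Rightarrow> 'b::real_normed_vector) \<Rightarrow> bool" where
  "smooth_on S f \<longleftrightarrow> open S \<and> (\<forall>n. C_k_on n S f)"

section \<open>The torus\<close>

definition torus :: "(complex ^ 'k::finite) set" where
  "torus = {z. \<forall>i. norm (z $ i) = 1}"

definition torus_exp :: "real ^ 'k \<Rightarrow> complex ^ 'k::finite" where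
  "torus_exp \<theta> = (\<chi> i. cis (\<theta> $ i))"

definition torus_power :: "complex ^ 'k \<Rightarrow> int ^ 'k \<Rightarrow> complex" where
  "torus_power z n = (\<Prod>i\<in>UNIV. (z $ i) powi (n $ i))"

text \<open>Smoothness on a relatively open subset \<open>W\<close> of the manifold \<open>\<real>\<^sup>k \<times> torus\<close>. The charts
  of the torus are the local inverses of the covering \<open>torus_exp\<close>; since smoothness is a local property,
  smoothness in all these charts is smoothness of the pullback along \<open>id \<times> torus_exp\<close> on
  the preimage of \<open>W\<close>.\<close>

definition smooth_on_Rk_torus ::
    "((real ^ 'k) \<times> (complex ^ 'k::finite)) set \<Rightarrow> (real ^ 'k \<Rightarrow> complex ^ 'k \<Rightarrow> complex) \<Rightarrow> bool" where
  "smooth_on_Rk_torus W F \<longleftrightarrow>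
     smooth_on {(x, \<theta>). (x, torus_exp \<theta>) \<in> W} (\<lambda>(x, \<theta>). F x (torus_exp \<theta>))"

section \<open>Homogeneous functions\<close>

text \<open>The value \<open>f 0\<close> is irrelevant. For \<open>t > 0\<close>, \<open>powr\<close> uses the real logarithm of \<open>t\<close>.\<close>

definition homogeneous_of_type ::
    "complex \<Rightarrow> int \<Rightarrow> ('a::real_vector \<Rightarrow> complex) \<Rightarrow> bool" where
  "homogeneous_of_type \<sigma> \<epsilon> f \<longleftrightarrow>
     (\<forall>t>0. \<forall>x. x \<noteq> 0 \<longrightarrow>
        f (t *\<^sub>R x) = of_real t powr \<sigma> * f x \<and> f (- x) = of_int \<epsilon> * f x)"

section \<open>t-summability\<close>

definition conv :: "('g::ab_group_add \<Rightarrow> complex) \<Rightarrow> ('g \<Rightarrow> complex) \<Rightarrow> 'g \<Rightarrow> complex" where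
  "conv c a \<gamma> = (\<Sum>\<gamma>' | c \<gamma>' \<noteq> 0. c \<gamma>' * a (\<gamma> - \<gamma>'))"

definition has_t_sum :: "('g::ab_group_add \<Rightarrow> complex) \<Rightarrow> complex \<Rightarrow> bool" where
  "has_t_sum a S \<longleftrightarrow>
     (\<exists>c. finite {\<gamma>. c \<gamma> \<noteq> 0} \<and> (\<Sum>\<gamma> | c \<gamma> \<noteq> 0. c \<gamma>) \<noteq> 0 \<and>
          (\<lambda>\<gamma>. norm (conv c a \<gamma>)) summable_on UNIV \<and>
          S = inverse (\<Sum>\<gamma> | c \<gamma> \<noteq> 0. c \<gamma>) * (\<Sum>\<^sub>\<infinity>\<gamma>. conv c a \<gamma>))"

definition t_summable :: "('g::ab_group_add \<Rightarrow> complex) \<Rightarrow> bool" where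
  "t_summable a \<longleftrightarrow>
     (\<exists>c. finite {\<gamma>. c \<gamma> \<noteq> 0} \<and> (\<Sum>\<gamma> | c \<gamma> \<noteq> 0. c \<gamma>) \<noteq> 0 \<and>
          (\<lambda>\<gamma>. norm (conv c a \<gamma>)) summable_on UNIV)"

definition t_sum :: "('g::ab_group_add \<Rightarrow> complex) \<Rightarrow> complex" where
  "t_sum a = (THE S. has_t_sum a S)"

lemma conv_has_sum:
  fixes c b :: "'g::ab_group_add \<Rightarrow> complex"
  assumes "(b has_sum B) UNIV" and fin: "finite {\<gamma>. c \<gamma> \<noteq> 0}"
  shows "(conv c b has_sum (\<Sum>\<gamma> | c \<gamma> \<noteq> 0. c \<gamma>) * B) UNIV"
proof -
  have "((\<lambda>\<gamma>. b (\<gamma> - g)) has_sum B) UNIV" for g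
  proof -
    have "bij (\<lambda>\<gamma>. \<gamma> - g)"
      by (rule bijI') (auto intro: exI[of _ "_ + g"])
    then show ?thesis
      using has_sum_reindex_bij_betw[of "\<lambda>\<gamma>. \<gamma> - g" UNIV UNIV b B] assms by simp
  qed
  then have "((\<lambda>\<gamma>. c g * b (\<gamma> - g)) has_sum c g * B) UNIV" for g
    by (rule has_sum_cmult_right)
  then have *: "((\<lambda>\<gamma>. c g * b (\<gamma> - g)) has_sum c g * B) UNIV" for g .
  have "((\<lambda>\<gamma>. \<Sum>g\<in>A. c g * b (\<gamma> - g)) has_sum (\<Sum>g\<in>A. c g * B)) UNIV"
    if "finite A" for A
    using that by induction (auto intro: has_sum_add *)
  from this[OF fin] show ?thesis
    by (simp add: conv_def[abs_def] sum_distrib_right)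
qed

lemma conv_left_commute: "conv c (conv d a) = conv d (conv c a)"
  by (rule ext, simp add: conv_def sum_distrib_left, subst sum.swap)
     (simp add: mult.left_commute diff_diff_eq add.commute)

lemma has_t_sum_unique:
  assumes "has_t_sum a S" "has_t_sum a S'"
  shows "S = S'"
proof -
  obtain c where fin_c: "finite {\<gamma>. c \<gamma> \<noteq> 0}" and c: "(\<Sum>\<gamma> | c \<gamma> \<noteq> 0. c \<gamma>) \<noteq> 0"
    "(\<lambda>\<gamma>. norm (conv c a \<gamma>)) summable_on UNIV"
    "S = inverse (\<Sum>\<gamma> | c \<gamma> \<noteq> 0. c \<gamma>) * (\<Sum>\<^sub>\<infinity>\<gamma>. conv c a \<gamma>)"
    using assms(1) unfolding has_t_sum_def by blast
  obtain d where fin_d: "finite {\<gamma>. d \<gamma> \<noteq> 0}" and d: "(\<Sum>\<gamma> | d \<gamma> \<noteq> 0. d \<gamma>) \<noteq> 0"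
    "(\<lambda>\<gamma>. norm (conv d a \<gamma>)) summable_on UNIV"
    "S' = inverse (\<Sum>\<gamma> | d \<gamma> \<noteq> 0. d \<gamma>) * (\<Sum>\<^sub>\<infinity>\<gamma>. conv d a \<gamma>)"
    using assms(2) unfolding has_t_sum_def by blast
  have "conv c a summable_on UNIV" "conv d a summable_on UNIV"
    using c(2) d(2) by (auto intro: abs_summable_summable)
  then have "(conv d (conv c a) has_sum (\<Sum>\<gamma> | d \<gamma> \<noteq> 0. d \<gamma>) * (\<Sum>\<^sub>\<infinity>\<gamma>. conv c a \<gamma>)) UNIV"
    and "(conv c (conv d a) has_sum (\<Sum>\<gamma> | c \<gamma> \<noteq> 0. c \<gamma>) * (\<Sum>\<^sub>\<infinity>\<gamma>. conv d a \<gamma>)) UNIV"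
    by (auto intro!: conv_has_sum has_sum_infsum fin_c fin_d)
  then have "(\<Sum>\<gamma> | d \<gamma> \<noteq> 0. d \<gamma>) * (\<Sum>\<^sub>\<infinity>\<gamma>. conv c a \<gamma>)
      = (\<Sum>\<gamma> | c \<gamma> \<noteq> 0. c \<gamma>) * (\<Sum>\<^sub>\<infinity>\<gamma>. conv d a \<gamma>)"
    by (metis conv_left_commute has_sum_unique)
  moreover have "(\<Sum>\<^sub>\<infinity>\<gamma>. conv c a \<gamma>) = S * (\<Sum>\<gamma> | c \<gamma> \<noteq> 0. c \<gamma>)"
    "(\<Sum>\<^sub>\<infinity>\<gamma>. conv d a \<gamma>) = S' * (\<Sum>\<gamma> | d \<gamma> \<noteq> 0. d \<gamma>)"
    using c(1,3) d(1,3) by (simp_all add: field_simps)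
  ultimately show ?thesis
    using c(1) d(1) by simp
qed

lemma t_sum_eqI: "has_t_sum a S \<Longrightarrow> t_sum a = S"
  unfolding t_sum_def by (blast intro: the_equality has_t_sum_unique)

definition t_summable_on :: "('g::ab_group_add \<Rightarrow> complex) \<Rightarrow> 'g set \<Rightarrow> bool" where
  "t_summable_on a M \<longleftrightarrow> t_summable (\<lambda>\<gamma>. if \<gamma> \<in> M then a \<gamma> else 0)"

definition t_sum_on :: "('g::ab_group_add \<Rightarrow> complex) \<Rightarrow> 'g set \<Rightarrow> complex" where
  "t_sum_on a M = t_sum (\<lambda>\<gamma>. if \<gamma> \<in> M then a \<gamma> else 0)"

section \<open>The series\<close>

definition of_int_vec :: "int ^ 'k \<Rightarrow> real ^ 'k::finite" where
  "of_int_vec n = (\<chi> i. of_int (n $ i))"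

definition D_set :: "(real ^ 'k::finite) set" where
  "D_set = UNIV - (range of_int_vec - {0})"

definition F_term ::
    "(real ^ 'k \<Rightarrow> complex) \<Rightarrow> real ^ 'k \<Rightarrow> complex ^ 'k \<Rightarrow> int ^ 'k::finite \<Rightarrow> complex" where
  "F_term f x z n = f (x + of_int_vec n) * torus_power z n"

definition F_sum ::
    "(real ^ 'k \<Rightarrow> complex) \<Rightarrow> real ^ 'k \<Rightarrow> complex ^ 'k::finite \<Rightarrow> complex" where
  "F_sum f x z = t_sum_on (F_term f x z) {n. n \<noteq> 0}"

end

theory Submission
  imports Defs
begin

text \<open>
  Fix a point with \<open>z\<^sub>i \<noteq> 1\<close>. Convolving the series \<open>\<Sum> f(x + n) z\<^sup>n\<close> with the coefficients of
  \<open>(1 - z\<^sub>i \<delta>)\<^sup>N\<close>, where \<open>\<delta>\<close> is the point mass at the \<open>i\<close>-th unit vector \<open>e\<^sub>i\<close>, is summation by parts: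
  up to finitely many \<open>n\<close> the terms become \<open>z\<^sup>n (\<nabla>\<^sup>N f)(x + n)\<close>, with \<open>\<nabla>\<close> the backward difference in
  the direction \<open>e\<^sub>i\<close> (\<open>conv_diff_coeff\<close>). The sum of the coefficients is \<open>(1 - z\<^sub>i)\<^sup>N \<noteq> 0\<close>. Each
  derivative of a homogeneous function is homogeneous of degree one less, so by the mean value theorem
  each difference gains a power of decay and \<open>(\<nabla>\<^sup>N f)(y) = O(|y|\<^bsup>- Re s - N\<^esup>)\<close> (\<open>bdiff_bound\<close>). For
  large \<open>N\<close> the convolved series converges absolutely, which is t-summability.

  For smoothness, the finitely many terms with small \<open>n\<close> are smooth on \<open>D\<close>. The remaining terms
  form a tail sum \<open>\<Sum> p(n) z\<^sup>n (\<nabla>\<^sup>N g)(x + n)\<close> with coefficients \<open>p\<close> of polynomial growth. Termwise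
  differentiation in \<open>x\<close> replaces \<open>g\<close> by a directional derivative, which improves the decay, and
  differentiation in the angles multiplies \<open>p(n)\<close> by a linear function of \<open>n\<close>, which costs one power
  (\<open>tail_sum_has_derivative\<close>). The class of such sums is therefore closed under differentiation, and the
  sum is of class \<open>C\<^sup>m\<close> as soon as \<open>N\<close> is large compared with \<open>m\<close> (\<open>tail_sum_C_k_on\<close>). Since the
  t-sum does not depend on the choice of \<open>N\<close>, it is of class \<open>C\<^sup>m\<close> for every \<open>m\<close>.
\<close>

section \<open>Calculus of functions of class \<open>C\<^sup>k\<close>\<close>

lemma C_k_on_cong:
  assumes "open S" "\<And>x. x \<in> S \<Longrightarrow> f x = g x" "C_k_on n S f"
  shows "C_k_on n S g"
  using assms(2,3)
proof (induction n arbitrary: f g)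
  case 0
  then show ?case by (simp cong: continuous_on_cong)
next
  case (Suc n)
  have diff: "f differentiable (at x)" if "x \<in> S" for x
    using Suc.prems(2) that by simp
  have "g differentiable (at x)" if "x \<in> S" for x
    using diff[OF that] that assms(1) Suc.prems(1)
    by (metis differentiable_def has_derivative_transform_within_open)
  moreover have "C_k_on n S (\<lambda>x. frechet_derivative g (at x) v)" for v
  proof (rule Suc.IH)
    show "C_k_on n S (\<lambda>x. frechet_derivative f (at x) v)" using Suc.prems(2) by simp
    show "frechet_derivative f (at x) v = frechet_derivative g (at x) v" if "x \<in> S" for x
      using frechet_derivative_transform_within_open[OF diff[OF that] assms(1) that] Suc.prems(1)
      by simp
  qed
  ultimately show ?case by simp
qed

lemma C_k_on_subset: "C_k_on n S f \<Longrightarrow> T \<subseteq> S \<Longrightarrow> C_k_on n T f"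
  by (induction n arbitrary: f) (auto intro: continuous_on_subset)

text \<open>The introduction rule used throughout: a derivative given by any formula, on an open set,
  can stand in for the one selected by \<^const>\<open>frechet_derivative\<close>.\<close>

lemma C_k_on_SucI:
  assumes "open S" "\<And>x. x \<in> S \<Longrightarrow> (f has_derivative f' x) (at x)"
    and "\<And>v. C_k_on n S (\<lambda>x. f' x v)"
  shows "C_k_on (Suc n) S f"
proof -
  have "C_k_on n S (\<lambda>x. frechet_derivative f (at x) v)" for v
    by (rule C_k_on_cong[OF assms(1) _ assms(3)[of v]])
      (use frechet_derivative_at[OF assms(2)] in auto)
  then show ?thesis using assms(2) by (auto simp: differentiable_def)
qed

lemma C_k_on_SucD:
  assumes "C_k_on (Suc n) S f"
  shows "x \<in> S \<Longrightarrow> (f has_derivative frechet_derivative f (at x)) (at x)"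
    and "C_k_on n S (\<lambda>x. frechet_derivative f (at x) v)"
  using assms by (auto simp: frechet_derivative_works)

lemma C_k_on_Suc_imp: "C_k_on (Suc n) S f \<Longrightarrow> C_k_on n S f"
proof (induction n arbitrary: f)
  case 0
  then show ?case
    by (auto intro!: differentiable_imp_continuous_on differentiable_at_imp_differentiable_on)
next
  case (Suc n)
  have "C_k_on (Suc n) S (\<lambda>x. frechet_derivative f (at x) v)" for v
    using C_k_on_SucD(2)[OF Suc.prems] .
  then have "C_k_on n S (\<lambda>x. frechet_derivative f (at x) v)" for v
    by (rule Suc.IH)
  then show ?case using Suc.prems by simp
qed

text \<open>Both differentiability and, inductively, the regularity of the derivatives are tested pointwise.
  The order of differentiability can thus be established with a different representation of the
  function near each point.\<close>

lemma C_k_on_local: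
  assumes "\<And>x. x \<in> S \<Longrightarrow> \<exists>T. open T \<and> x \<in> T \<and> C_k_on n T f"
  shows "C_k_on n S f"
  using assms
proof (induction n arbitrary: f)
  case 0
  have "isCont f x" if "x \<in> S" for x
    using 0[OF that] by (auto simp: continuous_on_eq_continuous_at)
  then show ?case by (auto intro: continuous_at_imp_continuous_on)
next
  case (Suc n)
  have "f differentiable (at x)" if "x \<in> S" for x
    using Suc.prems[OF that] by auto
  moreover have "C_k_on n S (\<lambda>x. frechet_derivative f (at x) v)" for v
    by (rule Suc.IH) (use Suc.prems in fastforce)
  ultimately show ?case by simp
qed

lemma C_k_on_const: "open S \<Longrightarrow> C_k_on n S (\<lambda>_. c)"
proof (induction n arbitrary: c)
  case (Suc n)
  then show ?case by (intro C_k_on_SucI[where f' = "\<lambda>_ _. 0"]) auto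
qed simp

lemma C_k_on_add:
  assumes "open S" "C_k_on n S f" "C_k_on n S g"
  shows "C_k_on n S (\<lambda>x. f x + g x)"
  using assms(2,3)
proof (induction n arbitrary: f g)
  case 0
  then show ?case by (simp add: continuous_on_add)
next
  case (Suc n)
  note D = C_k_on_SucD[OF Suc.prems(1)] C_k_on_SucD[OF Suc.prems(2)]
  show ?case
    by (rule C_k_on_SucI[OF assms(1)]) (auto intro!: has_derivative_add D Suc.IH)
qed

lemma C_k_on_sum:
  assumes "open S" "\<And>i. i \<in> I \<Longrightarrow> C_k_on n S (f i)"
  shows "C_k_on n S (\<lambda>x. \<Sum>i\<in>I. f i x)"
  using assms(2)
  by (induction I rule: infinite_finite_induct) (auto intro!: C_k_on_const C_k_on_add assms(1))

lemma C_k_on_mult: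
  fixes f g :: "'a::euclidean_space \<Rightarrow> 'b::real_normed_algebra"
  assumes "open S" "C_k_on n S f" "C_k_on n S g"
  shows "C_k_on n S (\<lambda>x. f x * g x)"
  using assms(2,3)
proof (induction n arbitrary: f g)
  case 0
  then show ?case by (simp add: continuous_on_mult)
next
  case (Suc n)
  note D = C_k_on_SucD[OF Suc.prems(1)] C_k_on_SucD[OF Suc.prems(2)]
  show ?case
    by (rule C_k_on_SucI[OF assms(1) has_derivative_mult[OF D(1,3)]])
      (simp_all add: C_k_on_add assms(1) Suc.IH D(2,4) C_k_on_Suc_imp[OF Suc.prems(1)]
        C_k_on_Suc_imp[OF Suc.prems(2)])
qed

lemma C_k_on_power:
  fixes f :: "'a::euclidean_space \<Rightarrow> 'b::real_normed_algebra_1"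
  assumes "open S" "C_k_on n S f"
  shows "C_k_on n S (\<lambda>x. f x ^ N)"
  by (induction N) (auto intro!: C_k_on_const C_k_on_mult assms)

lemma C_k_on_inverse:
  fixes f :: "'a::euclidean_space \<Rightarrow> 'b::real_normed_field"
  assumes "open S" "\<And>x. x \<in> S \<Longrightarrow> f x \<noteq> 0" "C_k_on n S f"
  shows "C_k_on n S (\<lambda>x. inverse (f x))"
  using assms(3)
proof (induction n)
  case 0
  then show ?case using assms(2) by (simp add: continuous_on_inverse)
next
  case (Suc n)
  note D = C_k_on_SucD[OF Suc.prems]
  have inv: "C_k_on n S (\<lambda>x. inverse (f x))"
    by (rule Suc.IH[OF C_k_on_Suc_imp[OF Suc.prems]])
  show ?case
  proof (rule C_k_on_SucI[OF assms(1) Deriv.has_derivative_inverse[OF assms(2) D(1)]])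
    show "C_k_on n S (\<lambda>x. - (inverse (f x) * frechet_derivative f (at x) v * inverse (f x)))" for v
      using C_k_on_mult[OF assms(1) C_k_on_const[OF assms(1), of _ "-1"]
          C_k_on_mult[OF assms(1) C_k_on_mult[OF assms(1) inv D(2)] inv]] by simp
  qed
qed

lemma C_k_on_compose_affine:
  fixes L :: "'a::euclidean_space \<Rightarrow> 'b::euclidean_space"
  assumes "open S" "bounded_linear L" "\<And>x. x \<in> S \<Longrightarrow> L x + a \<in> T" "C_k_on n T g"
  shows "C_k_on n S (\<lambda>x. g (L x + a))"
  using assms(4)
proof (induction n arbitrary: g)
  case 0
  have "continuous_on S (\<lambda>x. L x + a)"
    by (intro continuous_intros bounded_linear.continuous_on[OF assms(2)])
  then show ?case
    using 0 assms(3) by (auto intro: continuous_on_compose2[of T g])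
next
  case (Suc n)
  note D = C_k_on_SucD[OF Suc.prems]
  have L: "((\<lambda>x. L x + a) has_derivative L) (at x)" for x
    using has_derivative_add[OF bounded_linear_imp_has_derivative[OF assms(2)] has_derivative_const]
    by simp
  show ?case
    by (rule C_k_on_SucI[OF assms(1) has_derivative_compose[OF L D(1)]])
      (auto intro!: assms(3) Suc.IH D(2))
qed

lemma C_k_on_cis:
  fixes l :: "'a::euclidean_space \<Rightarrow> real"
  assumes "open S" "bounded_linear l"
  shows "C_k_on n S (\<lambda>x. cis (l x))"
proof (induction n)
  case 0
  show ?case by (auto intro!: continuous_intros bounded_linear.continuous_on[OF assms(2)])
next
  case (Suc n)
  have d: "((\<lambda>x. cis (l x)) has_derivative (\<lambda>v. (\<i> * of_real (l v)) * cis (l x))) (at x)" for x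
    using bounded_linear_imp_has_derivative[OF assms(2)]
    by (auto intro!: derivative_eq_intros simp: scaleR_conv_of_real ac_simps)
  show ?case
    by (rule C_k_on_SucI[OF assms(1) d]) (intro C_k_on_mult C_k_on_const Suc assms(1))
qed

section \<open>Differentiation of infinite sums\<close>

text \<open>Termwise differentiation of an absolutely convergent family whose derivatives have a summable
  majorant. It reduces to the theorem on series of functions by enumerating the index set.\<close>

lemma has_derivative_infsum:
  fixes f :: "'i::countable \<Rightarrow> 'a::real_normed_vector \<Rightarrow> 'b::banach"
  assumes inf: "infinite (UNIV :: 'i set)" and "convex S" "open S"
    and f': "\<And>i x. x \<in> S \<Longrightarrow> (f i has_derivative f' i x) (at x)"
    and M: "M summable_on UNIV" "\<And>i x h. x \<in> S \<Longrightarrow> norm (f' i x h) \<le> M i * norm h"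
    and f: "\<And>x. x \<in> S \<Longrightarrow> (\<lambda>i. norm (f i x)) summable_on UNIV"
    and x: "x \<in> S"
  shows "((\<lambda>x. \<Sum>\<^sub>\<infinity>i. f i x) has_derivative (\<lambda>h. \<Sum>\<^sub>\<infinity>i. f' i x h)) (at x)"
proof -
  define b :: "nat \<Rightarrow> 'i" where "b = from_nat_into UNIV"
  have b: "bij_betw b UNIV UNIV"
    unfolding b_def using inf by (intro bij_betw_from_nat_into) auto
  have sums: "(\<lambda>n. g (b n)) sums (\<Sum>\<^sub>\<infinity>i. g i)"
    if "(\<lambda>i. norm (g i)) summable_on UNIV" for g :: "'i \<Rightarrow> 'b"
  proof -
    have "(g has_sum (\<Sum>\<^sub>\<infinity>i. g i)) UNIV"
      using abs_summable_summable[OF that] by simp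
    then have "((\<lambda>n. g (b n)) has_sum (\<Sum>\<^sub>\<infinity>i. g i)) UNIV"
      using has_sum_reindex_bij_betw[OF b] by blast
    then show ?thesis by (rule has_sum_imp_sums)
  qed
  have Mb: "summable (\<lambda>n. M (b n))"
    using M(1) summable_on_reindex_bij_betw[OF b, of M] by (auto dest: summable_on_imp_summable)
  have f'sum: "(\<lambda>i. norm (f' i y h)) summable_on UNIV" if "y \<in> S" for y h
    by (rule summable_on_comparison_test[OF summable_on_cmult_left[OF M(1), of "norm h"]])
      (use M(2)[OF that] in auto)
  have "\<exists>g. \<forall>y\<in>S. (\<lambda>n. f (b n) y) sums g y \<and>
      (g has_derivative (\<lambda>h. \<Sum>\<^sub>\<infinity>i. f' i y h)) (at y within S)"
  proof (rule has_derivative_series[where f = "\<lambda>n. f (b n)" and f' = "\<lambda>n. f' (b n)", OF assms(2)])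
    show "x \<in> S" "(\<lambda>n. f (b n) x) sums (\<Sum>\<^sub>\<infinity>i. f i x)"
      by (rule x, rule sums[OF f[OF x]])
    show "(f (b n) has_derivative f' (b n) y) (at y within S)" if "y \<in> S" for n y
      using f'[OF that] by (rule has_derivative_at_withinI)
  next
    fix e :: real assume "e > 0"
    obtain N where N: "\<And>n. n \<ge> N \<Longrightarrow> norm (\<Sum>i. M (b (i + n))) < e"
      using suminf_exist_split[OF \<open>e > 0\<close> Mb] by blast
    have "norm ((\<Sum>i<n. f' (b i) y h) - (\<Sum>\<^sub>\<infinity>i. f' i y h)) \<le> e * norm h"
      if n: "n \<ge> N" and y: "y \<in> S" for n y h
    proof -
      have s: "(\<lambda>n. f' (b n) y h) sums (\<Sum>\<^sub>\<infinity>i. f' i y h)"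
        by (rule sums[OF f'sum[OF y]])
      then have "(\<Sum>\<^sub>\<infinity>i. f' i y h) - (\<Sum>i<n. f' (b i) y h) = (\<Sum>i. f' (b (i + n)) y h)"
        using suminf_minus_initial_segment[of "\<lambda>n. f' (b n) y h" n] by (auto simp: sums_iff)
      then have "norm ((\<Sum>i<n. f' (b i) y h) - (\<Sum>\<^sub>\<infinity>i. f' i y h)) = norm (\<Sum>i. f' (b (i + n)) y h)"
        by (metis norm_minus_commute)
      also have "\<dots> \<le> (\<Sum>i. M (b (i + n)) * norm h)"
        using M(2)[OF y] summable_ignore_initial_segment[OF Mb]
        by (intro norm_suminf_le summable_mult2) auto
      also have "\<dots> = (\<Sum>i. M (b (i + n))) * norm h"
        by (rule suminf_mult2[symmetric]) (rule summable_ignore_initial_segment[OF Mb])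
      also have "\<dots> \<le> e * norm h"
        using N[OF n] by (intro mult_right_mono) auto
      finally show ?thesis .
    qed
    then show "\<forall>\<^sub>F n in sequentially. \<forall>y\<in>S. \<forall>h.
        norm ((\<Sum>i<n. f' (b i) y h) - (\<Sum>\<^sub>\<infinity>i. f' i y h)) \<le> e * norm h"
      unfolding eventually_sequentially by blast
  qed
  then obtain g where g: "\<And>y. y \<in> S \<Longrightarrow> (\<lambda>n. f (b n) y) sums g y"
    "\<And>y. y \<in> S \<Longrightarrow> (g has_derivative (\<lambda>h. \<Sum>\<^sub>\<infinity>i. f' i y h)) (at y within S)"
    by blast
  have "(g has_derivative (\<lambda>h. \<Sum>\<^sub>\<infinity>i. f' i x h)) (at x)"
    using g(2)[OF x] at_within_open[OF x assms(3)] by simp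
  then show ?thesis
    by (rule has_derivative_transform_within_open[OF _ assms(3) x])
      (use g(1) sums[OF f] sums_unique2 in blast)
qed

section \<open>The integer lattice\<close>

lemma infinite_UNIV_int_vec: "infinite (UNIV :: (int ^ 'k::finite) set)"
proof
  assume "finite (UNIV :: (int ^ 'k) set)"
  moreover have "inj (vec :: int \<Rightarrow> int ^ 'k)"
    by (auto simp: inj_on_def vec_eq_iff)
  ultimately show False
    using finite_imageD[of vec "UNIV :: int set"] infinite_UNIV_int
    by (meson finite_subset subset_UNIV)
qed

lemma summable_on_int_inverse_square: "(\<lambda>i::int. inverse ((1 + \<bar>real_of_int i\<bar>)\<^sup>2)) summable_on UNIV"
proof -
  let ?g = "\<lambda>i::int. inverse ((1 + \<bar>real_of_int i\<bar>)\<^sup>2)"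
  have "summable (\<lambda>n. inverse (real n ^ 2))"
    by (rule inverse_power_summable) simp
  then have "summable (\<lambda>n. inverse (real (Suc n) ^ 2))"
    by (rule summable_Suc_iff[THEN iffD2])
  then have nat: "(\<lambda>n. inverse (real (Suc n) ^ 2)) summable_on UNIV"
    by (rule summable_nonneg_imp_summable_on) simp
  have "?g summable_on range int"
    using nat by (subst summable_on_reindex) (auto simp: o_def)
  moreover have "?g summable_on range (\<lambda>n. - int n)"
    using nat by (subst summable_on_reindex) (auto simp: o_def inj_on_def)
  ultimately have "?g summable_on (range int \<union> range (\<lambda>n. - int n))"
    by (rule summable_on_union)
  moreover have "range int \<union> range (\<lambda>n. - int n) = UNIV"
  proof -
    have "i \<in> range int \<union> range (\<lambda>n. - int n)" for i
      by (cases i rule: int_cases2) auto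
    then show ?thesis by blast
  qed
  ultimately show ?thesis by simp
qed

lemma norm_of_int_vec_ge_1:
  assumes "n \<noteq> 0" shows "norm (of_int_vec n) \<ge> 1"
proof -
  obtain i where "n $ i \<noteq> 0" using assms by (auto simp: vec_eq_iff)
  then have "1 \<le> \<bar>of_int_vec n $ i\<bar>" by (simp add: of_int_vec_def)
  also have "\<dots> \<le> norm (of_int_vec n)" by (rule component_le_norm_cart)
  finally show ?thesis .
qed

text \<open>The exponent \<open>-2k\<close> is cruder than the optimal bound, and it allows a comparison
  with a product of one-dimensional series: for \<open>n \<noteq> 0\<close> every factor \<open>1 + |n\<^sub>i|\<close> is at most \<open>2 |n|\<close>. The
  term at \<open>n = 0\<close> vanishes because \<open>0 powr a = 0\<close>.\<close>

lemma summable_on_lattice_norm_powr: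
  assumes "a \<le> - 2 * real CARD('k)"
  shows "(\<lambda>n :: int ^ 'k::finite. norm (of_int_vec n) powr a) summable_on UNIV"
proof -
  let ?P = "\<lambda>n :: int ^ 'k. \<Prod>i\<in>UNIV. inverse ((1 + \<bar>real_of_int (n $ i)\<bar>)\<^sup>2)"
  have "Infinite_Set_Sum.abs_summable_on
      (\<lambda>g :: 'k \<Rightarrow> int. \<Prod>i\<in>UNIV. inverse ((1 + \<bar>real_of_int (g i)\<bar>)\<^sup>2)) (PiE UNIV (\<lambda>_. UNIV))"
    by (rule abs_summable_on_prod_PiE)
      (use summable_on_int_inverse_square in \<open>auto simp flip: abs_summable_equivalent\<close>)
  then have "(\<lambda>g :: 'k \<Rightarrow> int. \<Prod>i\<in>UNIV. inverse ((1 + \<bar>real_of_int (g i)\<bar>)\<^sup>2)) summable_on UNIV"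
    by (simp flip: abs_summable_equivalent add: prod_nonneg flip: abs_prod)
  moreover have "bij (vec_nth :: int ^ 'k \<Rightarrow> _)"
    by (rule bijI') (auto simp: vec_eq_iff intro: exI[of _ "vec_lambda _"] vec_lambda_beta[symmetric])
  ultimately have P: "?P summable_on UNIV"
    using summable_on_reindex_bij_betw[of vec_nth UNIV UNIV] by fastforce
  have bound: "norm (of_int_vec n) powr a \<le> 4 ^ CARD('k) * ?P n" for n :: "int ^ 'k"
  proof (cases "n = 0")
    case True
    then have "of_int_vec n = 0" by (simp add: of_int_vec_def vec_eq_iff)
    then show ?thesis by (simp add: prod_nonneg)
  next
    case False
    let ?r = "norm (of_int_vec n)"
    note r = norm_of_int_vec_ge_1[OF False]
    have comp: "1 + \<bar>real_of_int (n $ i)\<bar> \<le> 2 * ?r" for i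
      using component_le_norm_cart[of "of_int_vec n" i] r by (simp add: of_int_vec_def)
    have "?r powr a \<le> ?r powr (- 2 * real CARD('k))"
      using r assms by (intro powr_mono) auto
    also have "\<dots> = inverse (?r\<^sup>2) ^ CARD('k)"
      using r powr_realpow[of ?r "2 * CARD('k)"]
      by (cases "of_int_vec n = 0") (simp_all add: powr_minus power_mult power_inverse)
    also have "\<dots> = (\<Prod>i\<in>(UNIV::'k set). inverse (?r\<^sup>2))" by simp
    also have "\<dots> \<le> (\<Prod>i\<in>(UNIV::'k set). 4 * inverse ((1 + \<bar>real_of_int (n $ i)\<bar>)\<^sup>2))"
    proof (rule prod_mono, safe)
      fix i
      have nz: "1 + \<bar>real_of_int (n $ i)\<bar> \<noteq> 0" by linarith
      have "(1 + \<bar>real_of_int (n $ i)\<bar>)\<^sup>2 \<le> (2 * ?r)\<^sup>2"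
        by (rule power_mono[OF comp]) simp
      then show "inverse (?r\<^sup>2) \<le> 4 * inverse ((1 + \<bar>real_of_int (n $ i)\<bar>)\<^sup>2)"
        using r nz by (simp add: divide_simps power_mult_distrib)
    qed simp
    also have "\<dots> = 4 ^ CARD('k) * ?P n" by (simp add: prod.distrib)
    finally show ?thesis .
  qed
  show ?thesis
    by (rule summable_on_comparison_test[OF summable_on_cmult_right[OF P, of "4 ^ CARD('k)"]])
      (use bound in auto)
qed

section \<open>Homogeneous functions and their iterated differences\<close>

text \<open>A class closed under directional derivatives, which lower the degree by one; positive homogeneity
  determines the growth of the function.\<close>

definition smooth_homogeneous :: "complex \<Rightarrow> ('a::euclidean_space \<Rightarrow> complex) \<Rightarrow> bool" where
  "smooth_homogeneous \<sigma> g \<longleftrightarrow> smooth_on (UNIV - {0}) g \<and>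
     (\<forall>t>0. \<forall>x. x \<noteq> 0 \<longrightarrow> g (t *\<^sub>R x) = of_real t powr \<sigma> * g x)"

abbreviation dir_deriv :: "('a::euclidean_space \<Rightarrow> complex) \<Rightarrow> 'a \<Rightarrow> 'a \<Rightarrow> complex" where
  "dir_deriv g v \<equiv> \<lambda>x. frechet_derivative g (at x) v"

lemma open_punctured: "open (UNIV - {0::'a::euclidean_space})"
  by (simp add: open_delete)

lemma smooth_homogeneous_has_derivative:
  assumes "smooth_homogeneous \<sigma> g" "x \<noteq> 0"
  shows "(g has_derivative frechet_derivative g (at x)) (at x)"
proof -
  have "C_k_on (Suc 0) (UNIV - {0}) g"
    using assms(1) unfolding smooth_homogeneous_def smooth_on_def by blast
  from C_k_on_SucD(1)[OF this] assms(2) show ?thesis by simp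
qed

text \<open>Differentiating \<open>g (t y) = t\<^sup>\<sigma> g y\<close> at \<open>x\<close> in the direction \<open>u\<close> produces an extra factor \<open>t\<close> on the
  left-hand side.\<close>

lemma smooth_homogeneous_dir_deriv:
  assumes "smooth_homogeneous \<sigma> g"
  shows "smooth_homogeneous (\<sigma> - 1) (dir_deriv g u)"
  unfolding smooth_homogeneous_def
proof (intro conjI allI impI)
  show "smooth_on (UNIV - {0}) (dir_deriv g u)"
    using assms C_k_on_SucD(2) unfolding smooth_homogeneous_def smooth_on_def by blast
next
  fix t :: real and x :: 'a
  assume t: "t > 0" and x: "x \<noteq> 0"
  have "((\<lambda>y. g (t *\<^sub>R y)) has_derivative (\<lambda>v. frechet_derivative g (at (t *\<^sub>R x)) (t *\<^sub>R v))) (at x)"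
    by (rule has_derivative_compose[OF _ smooth_homogeneous_has_derivative[OF assms]])
      (use t x in \<open>auto intro!: derivative_eq_intros\<close>)
  moreover have "((\<lambda>y. g (t *\<^sub>R y)) has_derivative
      (\<lambda>v. of_real t powr \<sigma> * frechet_derivative g (at x) v)) (at x)"
  proof (rule has_derivative_transform_within_open[OF _ open_punctured])
    show "((\<lambda>y. of_real t powr \<sigma> * g y) has_derivative
      (\<lambda>v. of_real t powr \<sigma> * frechet_derivative g (at x) v)) (at x)"
      by (intro has_derivative_mult_right smooth_homogeneous_has_derivative[OF assms x])
    show "of_real t powr \<sigma> * g y = g (t *\<^sub>R y)" if "y \<in> UNIV - {0}" for y
      using assms t that unfolding smooth_homogeneous_def by auto
  qed (use x in simp)
  ultimately have "frechet_derivative g (at (t *\<^sub>R x)) (t *\<^sub>R u)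
      = of_real t powr \<sigma> * frechet_derivative g (at x) u"
    by (metis has_derivative_unique)
  moreover have "linear (frechet_derivative g (at (t *\<^sub>R x)))"
    using smooth_homogeneous_has_derivative[OF assms, of "t *\<^sub>R x"] t x
    by (auto intro: has_derivative_linear)
  ultimately have "t *\<^sub>R frechet_derivative g (at (t *\<^sub>R x)) u
      = of_real t powr \<sigma> * frechet_derivative g (at x) u"
    by (simp add: linear_cmul)
  then show "frechet_derivative g (at (t *\<^sub>R x)) u
      = of_real t powr (\<sigma> - 1) * frechet_derivative g (at x) u"
    using t by (simp add: powr_diff scaleR_conv_of_real field_simps)
qed

text \<open>The constant bounds \<open>|g|\<close> on the compact unit sphere.\<close>

lemma smooth_homogeneous_bound:
  assumes "smooth_homogeneous \<sigma> g"
  obtains C where "C \<ge> 0" "\<And>y. y \<noteq> 0 \<Longrightarrow> norm (g y) \<le> C * norm y powr Re \<sigma>"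
proof -
  have "continuous_on (sphere 0 1) g"
    using assms C_k_on.simps(1)[of "UNIV - {0}" g] unfolding smooth_homogeneous_def smooth_on_def
    by (auto intro: continuous_on_subset)
  then have "bounded (g ` sphere 0 1)"
    by (intro compact_imp_bounded compact_continuous_image) auto
  then obtain C where C: "C > 0" "\<And>y. norm y = 1 \<Longrightarrow> norm (g y) \<le> C"
    unfolding bounded_pos by auto
  have "norm (g y) \<le> C * norm y powr Re \<sigma>" if "y \<noteq> 0" for y
  proof -
    have "g (norm y *\<^sub>R (y /\<^sub>R norm y)) = of_real (norm y) powr \<sigma> * g (y /\<^sub>R norm y)"
      using assms that unfolding smooth_homogeneous_def by (metis divideR_right norm_eq_zero
          scaleR_eq_0_iff inverse_nonzero_iff_nonzero zero_less_norm_iff)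
    then have "norm (g y) = norm y powr Re \<sigma> * norm (g (y /\<^sub>R norm y))"
      using that by (simp add: norm_mult norm_powr_real_powr)
    also have "\<dots> \<le> norm y powr Re \<sigma> * C"
      using that by (intro mult_left_mono C(2)) auto
    finally show ?thesis by (simp add: mult.commute)
  qed
  with C(1) show thesis by (intro that[of C]) auto
qed

text \<open>The \<open>N\<close>-th iterated backward difference with step \<open>e\<close>. The closed form makes
  linearity and termwise differentiation immediate; the recursion is \<open>bdiff_Suc\<close>.\<close>

definition bdiff :: "'a::real_vector \<Rightarrow> nat \<Rightarrow> ('a \<Rightarrow> complex) \<Rightarrow> 'a \<Rightarrow> complex" where
  "bdiff e N g y = (\<Sum>j\<le>N. (-1) ^ j * of_nat (N choose j) * g (y - real j *\<^sub>R e))"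

lemma bdiff_0 [simp]: "bdiff e 0 g y = g y"
  by (simp add: bdiff_def)

lemma bdiff_Suc: "bdiff e (Suc N) g y = bdiff e N g y - bdiff e N g (y - e)"
proof -
  let ?h = "\<lambda>j. g (y - real j *\<^sub>R e)"
  have shift: "y - e - real j *\<^sub>R e = y - real (Suc j) *\<^sub>R e" for j
    by (simp add: algebra_simps)
  have top: "(\<Sum>j\<le>N. (-1) ^ Suc j * of_nat (N choose Suc j) * ?h (Suc j)) + ?h 0
      = (\<Sum>j\<le>N. (-1) ^ j * of_nat (N choose j) * ?h j)"
  proof -
    have "(\<Sum>j\<le>Suc N. (-1) ^ j * of_nat (N choose j) * ?h j)
        = ?h 0 + (\<Sum>j\<le>N. (-1) ^ Suc j * of_nat (N choose Suc j) * ?h (Suc j))"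
      by (subst sum.atMost_Suc_shift) simp
    then show ?thesis by (simp add: add.commute binomial_eq_0)
  qed
  have "bdiff e (Suc N) g y
      = ?h 0 + (\<Sum>j\<le>N. (-1) ^ Suc j * of_nat (Suc N choose Suc j) * ?h (Suc j))"
    unfolding bdiff_def by (subst sum.atMost_Suc_shift) simp
  also have "\<dots> = (\<Sum>j\<le>N. (-1) ^ j * of_nat (N choose j) * ?h j)
      - (\<Sum>j\<le>N. (-1) ^ j * of_nat (N choose j) * ?h (Suc j))"
    unfolding top[symmetric] by (simp add: sum.distrib[symmetric] sum_subtractf[symmetric] algebra_simps
        flip: sum_negf)
  finally show ?thesis
    unfolding bdiff_def shift by simp
qed

lemma norm_shift_ge:
  assumes "norm e \<le> 1" "0 \<le> t"
  shows "norm y - t \<le> norm (y - t *\<^sub>R e)"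
proof -
  have "norm (t *\<^sub>R e) \<le> t" using assms mult_left_mono[of "norm e" 1 t] by simp
  then show ?thesis using norm_triangle_ineq2[of y "t *\<^sub>R e"] by linarith
qed

text \<open>The lower bound on \<open>|y|\<close> keeps all the points \<open>y, y - e, \<dots>, y - N e\<close> away from the origin.\<close>

lemma bdiff_has_derivative:
  assumes "smooth_homogeneous \<sigma> g" "norm e \<le> 1" "norm y > N"
  shows "(bdiff e N g has_derivative (\<lambda>v. bdiff e N (dir_deriv g v) y)) (at y)"
proof -
  have "((\<lambda>y. g (y - real j *\<^sub>R e)) has_derivative
      (\<lambda>v. frechet_derivative g (at (y - real j *\<^sub>R e)) v)) (at y)" if "j \<le> N" for j
  proof (rule has_derivative_compose[OF _ smooth_homogeneous_has_derivative[OF assms(1)]])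
    show "((\<lambda>y. y - real j *\<^sub>R e) has_derivative (\<lambda>v. v)) (at y)"
      by (auto intro!: derivative_eq_intros)
    show "y - real j *\<^sub>R e \<noteq> 0"
      using norm_shift_ge[OF assms(2), of "real j" y] assms(3) that by auto
  qed
  then show ?thesis
    unfolding bdiff_def by (intro has_derivative_sum has_derivative_mult_right) auto
qed

text \<open>The absolute value of \<open>\<tau>\<close> in the constant covers both signs of the exponent at once.\<close>

lemma powr_comparable:
  fixes a b \<tau> :: real
  assumes "0 < b" "b / 2 \<le> a" "a \<le> 2 * b"
  shows "a powr \<tau> \<le> 2 powr \<bar>\<tau>\<bar> * b powr \<tau>"
proof (cases "\<tau> \<ge> 0")
  case True
  then have "a powr \<tau> \<le> (2 * b) powr \<tau>" using assms by (intro powr_mono2) auto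
  then show ?thesis using True assms by (simp add: powr_mult)
next
  case False
  then have "a powr \<tau> \<le> (b / 2) powr \<tau>" using assms by (intro powr_mono2') auto
  then show ?thesis using False assms by (simp add: powr_divide powr_minus_divide)
qed

text \<open>Each difference gains one power of decay. By the mean value theorem the difference
  \<open>bdiff e N g (y - e) - bdiff e N g y\<close> is controlled by \<open>bdiff e N\<close> of the derivative of
  \<open>g\<close> in the direction \<open>e\<close> along the segment from \<open>y\<close> to \<open>y - e\<close>, and that derivative is homogeneous of
  degree one less. The induction therefore has to range over all homogeneous functions.\<close>

lemma bdiff_bound:
  assumes "smooth_homogeneous \<sigma> g" "norm e \<le> 1"
  shows "\<exists>C\<ge>0. \<forall>y. norm y \<ge> real N + 1 \<longrightarrow> norm (bdiff e N g y) \<le> C * norm y powr (Re \<sigma> - real N)"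
  using assms(1)
proof (induction N arbitrary: \<sigma> g)
  case 0
  then obtain C where C: "C \<ge> 0" "\<And>y. y \<noteq> 0 \<Longrightarrow> norm (g y) \<le> C * norm y powr Re \<sigma>"
    using smooth_homogeneous_bound by blast
  have "norm (g y) \<le> C * norm y powr Re \<sigma>" if "norm y \<ge> 1" for y
    using that by (intro C(2)) auto
  with C(1) show ?case by auto
next
  case (Suc N)
  let ?\<tau> = "Re \<sigma> - real (Suc N)"
  obtain C where C: "C \<ge> 0" "\<And>y. norm y \<ge> real N + 1 \<Longrightarrow>
      norm (bdiff e N (dir_deriv g e) y) \<le> C * norm y powr ?\<tau>"
    using Suc.IH[OF smooth_homogeneous_dir_deriv[OF Suc.prems, of e]] by (auto simp: algebra_simps)
  have "norm (bdiff e (Suc N) g y) \<le> C * 2 powr \<bar>?\<tau>\<bar> * norm y powr ?\<tau>"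
    if y: "norm y \<ge> real (Suc N) + 1" for y
  proof -
    \<comment> \<open>On the whole segment the norm is comparable to \<open>|y|\<close>, since \<open>|y| \<ge> 2\<close> and the step is at most 1.\<close>
    let ?p = "\<lambda>t. y - t *\<^sub>R e"
    have "norm (bdiff e N g (?p 1) - bdiff e N g (?p 0)) \<le> C * 2 powr \<bar>?\<tau>\<bar> * norm y powr ?\<tau> * norm (1 - 0 :: real)"
    proof (rule differentiable_bound[where S = "{0..1}" and f = "\<lambda>t. bdiff e N g (?p t)"
        and f' = "\<lambda>t s. bdiff e N (dir_deriv g (s *\<^sub>R (- e))) (?p t)"])
      fix t :: real assume t: "t \<in> {0..1}"
      have low: "norm y - 1 \<le> norm (?p t)"
        using norm_shift_ge[OF assms(2), of t y] t by auto
      have up: "norm (?p t) \<le> norm y + 1"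
      proof -
        have "norm (t *\<^sub>R e) \<le> 1" using assms(2) t mult_mono[of t 1 "norm e" 1] by simp
        then show ?thesis using norm_triangle_ineq4[of y "t *\<^sub>R e"] by linarith
      qed
      have pN: "norm (?p t) \<ge> real N + 1" using low y by simp
      let ?d = "\<lambda>s. bdiff e N (dir_deriv g (s *\<^sub>R (- e))) (?p t)"
      have "((\<lambda>t. bdiff e N g (?p t)) has_derivative ?d) (at t)"
        by (rule has_derivative_compose[OF _ bdiff_has_derivative[OF Suc.prems assms(2)]])
          (use pN in \<open>auto intro!: derivative_eq_intros\<close>)
      then show "((\<lambda>t. bdiff e N g (?p t)) has_derivative ?d) (at t within {0..1})"
        by (rule has_derivative_at_withinI)
      have "?d s = - (s *\<^sub>R bdiff e N (dir_deriv g e) (?p t))" for s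
        unfolding bdiff_def scaleR_sum_right sum_negf[symmetric]
      proof (rule sum.cong[OF refl])
        fix j assume j: "j \<in> {..N}"
        have "?p t - real j *\<^sub>R e \<noteq> 0"
          using norm_shift_ge[OF assms(2), of "real j" "?p t"] pN j by auto
        from has_derivative_linear[OF smooth_homogeneous_has_derivative[OF Suc.prems this]]
        show "(- 1) ^ j * of_nat (N choose j) * dir_deriv g (s *\<^sub>R - e) (?p t - real j *\<^sub>R e)
            = - (s *\<^sub>R ((- 1) ^ j * of_nat (N choose j) * dir_deriv g e (?p t - real j *\<^sub>R e)))"
          by (simp add: linear_cmul linear_neg)
      qed
      then have "norm (?d s) = norm (bdiff e N (dir_deriv g e) (?p t)) * norm s" for s
        by (simp add: mult.commute)
      moreover have "norm (bdiff e N (dir_deriv g e) (?p t)) \<le> C * (2 powr \<bar>?\<tau>\<bar> * norm y powr ?\<tau>)"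
        using y low up C(1)
        by (intro order.trans[OF C(2)[OF pN]] mult_left_mono powr_comparable) auto
      ultimately have "norm (?d s) \<le> C * (2 powr \<bar>?\<tau>\<bar> * norm y powr ?\<tau>) * norm s" for s
        by (metis mult_right_mono norm_ge_zero)
      then show "onorm ?d \<le> C * 2 powr \<bar>?\<tau>\<bar> * norm y powr ?\<tau>"
        by (intro onorm_le) (simp only: mult.assoc)
    qed auto
    then show ?thesis by (simp add: bdiff_Suc norm_minus_commute)
  qed
  with C(1) show ?case by (intro exI[of _ "C * 2 powr \<bar>?\<tau>\<bar>"]) auto
qed

section \<open>Tail sums\<close>

text \<open>Coefficients of polynomial growth \<open>d\<close> that vanish on a ball. The vanishing replaces a
  restriction of the summation to the complement of a finite set, so that all sums run over the whole
  lattice.\<close>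

definition tail_coeff :: "real \<Rightarrow> real \<Rightarrow> (int ^ 'k::finite \<Rightarrow> complex) \<Rightarrow> bool" where
  "tail_coeff \<rho> d p \<longleftrightarrow> (\<exists>C\<ge>0. \<forall>n. norm (p n) \<le> C * norm (of_int_vec n) powr d) \<and>
     (\<forall>n. p n \<noteq> 0 \<longrightarrow> 2 * \<rho> \<le> norm (of_int_vec n))"

text \<open>The general term of \<open>\<Sum>\<^sub>n p(n) z\<^sup>n (\<nabla>\<^sup>N g)(x + n)\<close> with \<open>z = exp(\<i>\<theta>)\<close>, as a function of
  \<open>w = (x, \<theta>)\<close>. The coefficients \<open>p\<close> and the function \<open>g\<close> are parameters because differentiation
  changes them and nothing else.\<close>

definition tail_term :: "(int ^ 'k \<Rightarrow> complex) \<Rightarrow> real ^ 'k \<Rightarrow> nat \<Rightarrow> (real ^ 'k \<Rightarrow> complex) \<Rightarrow>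
    int ^ 'k \<Rightarrow> (real ^ 'k) \<times> (real ^ 'k::finite) \<Rightarrow> complex" where
  "tail_term p e N g n w =
     p n * (cis (of_int_vec n \<bullet> snd w) * bdiff e N g (fst w + of_int_vec n))"

text \<open>The coefficients produced by differentiating \<open>exp(\<i> n \<bullet> \<theta>)\<close> in the direction \<open>v\<close>.\<close>

lemma tail_coeff_deriv:
  assumes "tail_coeff \<rho> d p"
  shows "tail_coeff \<rho> (d + 1) (\<lambda>n. \<i> * of_real (of_int_vec n \<bullet> v) * p n)"
proof -
  obtain C where C: "C \<ge> 0" "\<And>n. norm (p n) \<le> C * norm (of_int_vec n) powr d"
    using assms unfolding tail_coeff_def by blast
  have "norm (\<i> * of_real (of_int_vec n \<bullet> v) * p n)
      \<le> norm v * C * norm (of_int_vec n) powr (d + 1)" for n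
  proof -
    have "norm (\<i> * of_real (of_int_vec n \<bullet> v) * p n)
        \<le> (norm (of_int_vec n) * norm v) * (C * norm (of_int_vec n) powr d)"
      unfolding norm_mult[of _ "p n"] by (rule mult_mono) (use C Cauchy_Schwarz_ineq2 in \<open>auto simp: norm_mult\<close>)
    also have "\<dots> = norm v * C * norm (of_int_vec n) powr (d + 1)"
      by (cases "of_int_vec n = 0") (auto simp: powr_add)
    finally show ?thesis .
  qed
  then show ?thesis
    using assms C(1) unfolding tail_coeff_def by (intro conjI exI[of _ "norm v * C"]) auto
qed

text \<open>Where the coefficients do not vanish, \<open>x + n\<close> is so far from the origin that the differences
  up to order \<open>N\<close> avoid it, and its norm is comparable to that of \<open>n\<close>.\<close>

lemma tail_point_norm:
  assumes "norm x < r" "r + real N + 1 \<le> \<rho>" "2 * \<rho> \<le> norm (of_int_vec n)"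
  shows "real N + 1 \<le> norm (x + of_int_vec n)" "norm (of_int_vec n) / 2 \<le> norm (x + of_int_vec n)"
    "norm (x + of_int_vec n) \<le> 2 * norm (of_int_vec n)" "0 < norm (of_int_vec n)"
  using norm_triangle_ineq[of x "of_int_vec n"] norm_diff_ineq[of "of_int_vec n" x]
    norm_ge_zero[of x] assms by (auto simp: add.commute simp del: norm_ge_zero zero_less_norm_iff)

lemma tail_term_bound:
  assumes g: "smooth_homogeneous \<sigma> g" and e: "norm e \<le> 1" and p: "tail_coeff \<rho> d p"
    and \<rho>: "r + real N + 1 \<le> \<rho>"
  shows "\<exists>C\<ge>0. \<forall>n. \<forall>w\<in>ball 0 r \<times> UNIV.
    norm (tail_term p e N g n w) \<le> C * norm (of_int_vec n) powr (Re \<sigma> - real N + d)"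
proof -
  let ?\<tau> = "Re \<sigma> - real N"
  obtain C where C: "C \<ge> 0" "\<And>n. norm (p n) \<le> C * norm (of_int_vec n) powr d"
    using p unfolding tail_coeff_def by blast
  obtain B where B: "B \<ge> 0" "\<And>y. norm y \<ge> real N + 1 \<Longrightarrow> norm (bdiff e N g y) \<le> B * norm y powr ?\<tau>"
    using bdiff_bound[OF g e] by blast
  have "norm (tail_term p e N g n w)
      \<le> C * B * 2 powr \<bar>?\<tau>\<bar> * norm (of_int_vec n) powr (?\<tau> + d)"
    if w: "w \<in> ball 0 r \<times> UNIV" for n w
  proof (cases "p n = 0")
    case True
    then show ?thesis using C(1) B(1) by (simp add: tail_term_def)
  next
    case False
    then have "2 * \<rho> \<le> norm (of_int_vec n)" using p unfolding tail_coeff_def by blast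
    note y = tail_point_norm[OF _ \<rho> this, of "fst w"]
    have w': "norm (fst w) < r" using w by auto
    have "norm (bdiff e N g (fst w + of_int_vec n))
        \<le> B * (2 powr \<bar>?\<tau>\<bar> * norm (of_int_vec n) powr ?\<tau>)"
      by (intro order.trans[OF B(2)] mult_left_mono powr_comparable y w' B(1))
    then have "norm (tail_term p e N g n w)
        \<le> (C * norm (of_int_vec n) powr d) * (B * (2 powr \<bar>?\<tau>\<bar> * norm (of_int_vec n) powr ?\<tau>))"
      unfolding tail_term_def norm_mult norm_cis mult_1_left
      by (rule mult_mono[OF C(2)]) (use C(1) in auto)
    then show ?thesis by (simp add: powr_add ac_simps)
  qed
  then show ?thesis
    using C(1) B(1) by (intro exI[of _ "C * B * 2 powr \<bar>?\<tau>\<bar>"]) auto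
qed

lemma tail_term_summable:
  fixes g :: "real ^ 'k::finite \<Rightarrow> complex"
  assumes "smooth_homogeneous \<sigma> g" "norm e \<le> 1" "tail_coeff \<rho> d p" "r + real N + 1 \<le> \<rho>"
    and "Re \<sigma> - real N + d \<le> - 2 * real CARD('k)" "w \<in> ball 0 r \<times> UNIV"
  shows "(\<lambda>n. norm (tail_term p e N g n w)) summable_on UNIV"
proof -
  obtain C where C: "\<And>n. norm (tail_term p e N g n w)
      \<le> C * norm (of_int_vec n) powr (Re \<sigma> - real N + d)"
    using tail_term_bound[OF assms(1-4)] assms(6) by blast
  show ?thesis
    by (rule summable_on_comparison_test[OF summable_on_cmult_right])
      (use C summable_on_lattice_norm_powr[OF assms(5)] in auto)
qed

lemma tail_term_has_derivative:
  assumes g: "smooth_homogeneous \<sigma> g" and e: "norm e \<le> 1" and p: "tail_coeff \<rho> d p"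
    and \<rho>: "r + real N + 1 \<le> \<rho>" and w: "w \<in> ball 0 r \<times> UNIV"
  shows "(tail_term p e N g n has_derivative
      (\<lambda>h. tail_term p e N (dir_deriv g (fst h)) n w
         + tail_term (\<lambda>n. \<i> * of_real (of_int_vec n \<bullet> snd h) * p n) e N g n w)) (at w)"
proof (cases "p n = 0")
  case True
  then have "tail_term p e N g n = (\<lambda>_. 0)"
    by (simp add: fun_eq_iff tail_term_def)
  with True show ?thesis by (simp add: tail_term_def)
next
  case False
  then have n: "2 * \<rho> \<le> norm (of_int_vec n)" using p unfolding tail_coeff_def by blast
  have w': "norm (fst w) < r" using w by auto
  have "norm (fst w + of_int_vec n) > real N"
    using tail_point_norm(1)[OF w' \<rho> n] by simp
  then have b: "((\<lambda>w. bdiff e N g (fst w + of_int_vec n)) has_derivative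
      (\<lambda>h. bdiff e N (dir_deriv g (fst h)) (fst w + of_int_vec n))) (at w)"
    by (intro has_derivative_compose[OF _ bdiff_has_derivative[OF g e]])
      (auto intro!: derivative_eq_intros)
  have c: "((\<lambda>w. cis (of_int_vec n \<bullet> snd w)) has_derivative
      (\<lambda>h. (\<i> * of_real (of_int_vec n \<bullet> snd h)) * cis (of_int_vec n \<bullet> snd w))) (at w)"
    by (auto intro!: derivative_eq_intros simp: scaleR_conv_of_real ac_simps)
  show ?thesis
    unfolding tail_term_def
    by (rule has_derivative_eq_rhs[OF has_derivative_mult_right[OF has_derivative_mult[OF c b]]])
      (simp add: algebra_simps)
qed

text \<open>The derivative is again a combination of sums of the same kind: one for a directional derivative
  of \<open>g\<close>, whose terms decay better by one power, and one with coefficients growing by one more power.\<close>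

lemma tail_sum_has_derivative:
  fixes g :: "real ^ 'k::finite \<Rightarrow> complex"
  assumes g: "smooth_homogeneous \<sigma> g" and e: "norm e \<le> 1" and p: "tail_coeff \<rho> d p"
    and \<rho>: "r + real N + 1 \<le> \<rho>" and dec: "Re \<sigma> - real N + d + 1 \<le> - 2 * real CARD('k)"
    and w: "w \<in> ball 0 r \<times> UNIV"
  shows "((\<lambda>w. \<Sum>\<^sub>\<infinity>n. tail_term p e N g n w) has_derivative
      (\<lambda>h. (\<Sum>\<^sub>\<infinity>n. tail_term p e N (dir_deriv g (fst h)) n w)
         + (\<Sum>\<^sub>\<infinity>n. tail_term (\<lambda>n. \<i> * of_real (of_int_vec n \<bullet> snd h) * p n) e N g n w))) (at w)"
proof -
  let ?S = "ball (0 :: real ^ 'k) r \<times> (UNIV :: (real ^ 'k) set)"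
  let ?X = "\<lambda>h n w. tail_term p e N (dir_deriv g (fst h)) n w"
  let ?Y = "\<lambda>h n w. tail_term (\<lambda>n. \<i> * of_real (of_int_vec n \<bullet> snd h) * p n) e N g n w"
  note dg = smooth_homogeneous_dir_deriv[OF g]
  let ?a = "\<lambda>n :: int ^ 'k. norm (of_int_vec n) powr (Re \<sigma> - real N + d - 1)"
  let ?b = "\<lambda>n :: int ^ 'k. norm (of_int_vec n) powr (Re \<sigma> - real N + d + 1)"
  have "\<exists>C\<ge>0. \<forall>n. \<forall>w\<in>?S. norm (tail_term p e N (dir_deriv g b) n w) \<le> C * ?a n" for b
    using tail_term_bound[OF dg e p \<rho>, of b] by (simp add: algebra_simps)
  then obtain B where B: "\<And>b. B b \<ge> 0"
    "\<And>b n w. w \<in> ?S \<Longrightarrow> norm (tail_term p e N (dir_deriv g b) n w) \<le> B b * ?a n"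
    by metis
  obtain C where C: "C \<ge> 0"
    "\<And>n w. w \<in> ?S \<Longrightarrow> norm (tail_term p e N g n w) \<le> C * norm (of_int_vec n) powr (Re \<sigma> - real N + d)"
    using tail_term_bound[OF g e p \<rho>] by blast
  let ?M = "\<lambda>n. (\<Sum>b\<in>Basis. B b) * ?a n + C * ?b n"
  \<comment> \<open>The bound must be uniform in the direction; linearity reduces it to the finitely many basis directions.\<close>
  have X: "norm (?X h n w) \<le> (\<Sum>b\<in>Basis. B b) * ?a n * norm h" if "w \<in> ?S" for h n w
  proof -
    have lin: "?X h n w = (\<Sum>b\<in>Basis. (fst h \<bullet> b) *\<^sub>R tail_term p e N (dir_deriv g b) n w)"
    proof (cases "p n = 0")
      case False
      then have n: "2 * \<rho> \<le> norm (of_int_vec n)" using p unfolding tail_coeff_def by blast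
      have w': "norm (fst w) < r" using that by auto
      let ?y = "fst w + of_int_vec n"
      have y: "norm ?y > real N"
        using tail_point_norm(1)[OF w' \<rho> n] by simp
      have L: "linear (\<lambda>v. bdiff e N (dir_deriv g v) ?y)"
        by (rule has_derivative_linear[OF bdiff_has_derivative[OF g e y]])
      have "bdiff e N (dir_deriv g (\<Sum>b\<in>Basis. (fst h \<bullet> b) *\<^sub>R b)) ?y
          = (\<Sum>b\<in>Basis. (fst h \<bullet> b) *\<^sub>R bdiff e N (dir_deriv g b) ?y)"
        unfolding linear_sum[OF L] linear_cmul[OF L] ..
      then show ?thesis
        by (simp add: tail_term_def euclidean_representation sum_distrib_left)
    qed (simp add: tail_term_def)
    have "norm (?X h n w) \<le> (\<Sum>b\<in>Basis. norm h * (B b * ?a n))"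
      unfolding lin
    proof (rule sum_norm_le)
      fix b :: "real ^ 'k" assume b: "b \<in> Basis"
      have "\<bar>fst h \<bullet> b\<bar> \<le> norm h"
        using Basis_le_norm[OF b, of "fst h"] norm_fst_le[of "fst h" "snd h"] by simp
      then show "norm ((fst h \<bullet> b) *\<^sub>R tail_term p e N (dir_deriv g b) n w) \<le> norm h * (B b * ?a n)"
        unfolding norm_scaleR by (intro mult_mono B(2)[OF that]) auto
    qed
    also have "\<dots> = (\<Sum>b\<in>Basis. B b) * ?a n * norm h"
      by (simp add: sum_distrib_right sum_distrib_left ac_simps)
    finally show ?thesis .
  qed
  have Y: "norm (?Y h n w) \<le> C * ?b n * norm h" if "w \<in> ?S" for h :: "(real ^ 'k) \<times> (real ^ 'k)" and n w
  proof -
    have "?Y h n w = \<i> * of_real (of_int_vec n \<bullet> snd h) * tail_term p e N g n w"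
      by (simp add: tail_term_def)
    then have "norm (?Y h n w) = \<bar>of_int_vec n \<bullet> snd h\<bar> * norm (tail_term p e N g n w)"
      by (simp add: norm_mult)
    also have "\<dots> \<le> (norm (of_int_vec n) * norm h) * (C * norm (of_int_vec n) powr (Re \<sigma> - real N + d))"
    proof (rule mult_mono[OF _ C(2)[OF that]])
      have "norm (snd h) \<le> norm h" using norm_snd_le[of "snd h" "fst h"] by simp
      then show "\<bar>of_int_vec n \<bullet> snd h\<bar> \<le> norm (of_int_vec n) * norm h"
        by (intro order.trans[OF Cauchy_Schwarz_ineq2] mult_left_mono) auto
    qed auto
    also have "\<dots> = C * ?b n * norm h"
      by (cases "of_int_vec n = 0") (auto simp: powr_add)
    finally show ?thesis .
  qed
  have "((\<lambda>w. \<Sum>\<^sub>\<infinity>n. tail_term p e N g n w) has_derivative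
      (\<lambda>h. \<Sum>\<^sub>\<infinity>n. ?X h n w + ?Y h n w)) (at w)"
  proof (rule has_derivative_infsum[where S = ?S and M = ?M and f = "tail_term p e N g"
        and f' = "\<lambda>n w h. ?X h n w + ?Y h n w"])
    show "infinite (UNIV :: (int ^ 'k) set)" by (rule infinite_UNIV_int_vec)
    show "w \<in> ?S" by (rule w)
    show "convex ?S" by (intro convex_Times convex_ball convex_UNIV)
    show "open ?S" by (intro open_Times) auto
    show "(tail_term p e N g n has_derivative (\<lambda>h. ?X h n w + ?Y h n w)) (at w)" if "w \<in> ?S" for n w
      by (rule tail_term_has_derivative[OF g e p \<rho> that])
    show "?M summable_on UNIV"
      by (intro summable_on_add summable_on_cmult_right summable_on_lattice_norm_powr)
        (use dec in auto)
    show "norm (?X h n w + ?Y h n w) \<le> ?M n * norm h" if "w \<in> ?S" for n w h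
      using norm_triangle_ineq[of "?X h n w" "?Y h n w"] X[OF that, of h n] Y[OF that, of h n]
      by (simp add: algebra_simps)
    show "(\<lambda>n. norm (tail_term p e N g n w)) summable_on UNIV" if "w \<in> ?S" for w
      by (rule tail_term_summable[OF g e p \<rho> _ that]) (use dec in auto)
  qed
  moreover have "(\<Sum>\<^sub>\<infinity>n. ?X h n w + ?Y h n w) = (\<Sum>\<^sub>\<infinity>n. ?X h n w) + (\<Sum>\<^sub>\<infinity>n. ?Y h n w)" for h
  proof (rule infsum_add)
    show "(\<lambda>n. ?X h n w) summable_on UNIV"
      by (rule abs_summable_summable, rule tail_term_summable[OF dg e p \<rho> _ w]) (use dec in auto)
    show "(\<lambda>n. ?Y h n w) summable_on UNIV"
      by (rule abs_summable_summable, rule tail_term_summable[OF g e tail_coeff_deriv[OF p] \<rho> _ w])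
        (use dec in auto)
  qed
  ultimately show ?thesis by simp
qed

text \<open>The class of tail sums is closed under differentiation, so induction on the order works as long as
  enough differences have been taken. The extra \<open>1\<close> in the hypothesis lets the base case get
  continuity from differentiability.\<close>

lemma tail_sum_C_k_on:
  fixes g :: "real ^ 'k::finite \<Rightarrow> complex"
  assumes "smooth_homogeneous \<sigma> g" "norm e \<le> 1" "tail_coeff \<rho> d p" "r + real N + 1 \<le> \<rho>"
    and "Re \<sigma> - real N + d + real m + 1 \<le> - 2 * real CARD('k)"
  shows "C_k_on m (ball 0 r \<times> UNIV) (\<lambda>w. \<Sum>\<^sub>\<infinity>n. tail_term p e N g n w)"
  using assms
proof (induction m arbitrary: \<sigma> g d p)
  case 0
  then show ?case
    using has_derivative_continuous[OF tail_sum_has_derivative[OF 0(1-4)]]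
    by (auto intro!: continuous_at_imp_continuous_on)
next
  case (Suc m)
  have op: "open (ball (0 :: real ^ 'k) r \<times> (UNIV :: (real ^ 'k) set))"
    by (intro open_Times) auto
  show ?case
  proof (rule C_k_on_SucI[OF op tail_sum_has_derivative[OF Suc.prems(1-4)]])
    fix h :: "(real ^ 'k) \<times> (real ^ 'k)"
    show "C_k_on m (ball 0 r \<times> UNIV) (\<lambda>w. (\<Sum>\<^sub>\<infinity>n. tail_term p e N (dir_deriv g (fst h)) n w)
         + (\<Sum>\<^sub>\<infinity>n. tail_term (\<lambda>n. \<i> * of_real (of_int_vec n \<bullet> snd h) * p n) e N g n w))"
      by (intro C_k_on_add[OF op]
          Suc.IH[OF smooth_homogeneous_dir_deriv[OF Suc.prems(1)] Suc.prems(2-4)]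
          Suc.IH[OF Suc.prems(1,2) tail_coeff_deriv[OF Suc.prems(3)] Suc.prems(4)])
        (use Suc.prems(5) in auto)
  qed (use Suc.prems(5) in auto)
qed

section \<open>The torus and the domain\<close>

lemma torus_power_torus_exp: "torus_power (torus_exp \<theta>) n = cis (of_int_vec n \<bullet> \<theta>)"
proof -
  have "(\<Prod>i\<in>A. cis (\<theta> $ i) powi (n $ i)) = cis (\<Sum>i\<in>A. of_int (n $ i) * \<theta> $ i)" if "finite A" for A
    using that by induction (auto simp: cis_power_int cis_mult)
  then show ?thesis
    by (simp add: torus_power_def torus_exp_def of_int_vec_def inner_vec_def)
qed

lemma of_int_vec_diff: "of_int_vec (m - n) = of_int_vec m - of_int_vec n"
  by (simp add: of_int_vec_def vec_eq_iff)

lemma of_int_vec_axis: "of_int_vec (axis i (int j)) = real j *\<^sub>R axis i 1"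
  by (simp add: of_int_vec_def vec_eq_iff axis_def)

lemma torus_exp_surj:
  assumes "z \<in> torus"
  obtains \<theta> where "torus_exp \<theta> = z"
proof
  show "torus_exp (\<chi> i. Arg (z $ i)) = z"
  proof (simp add: torus_exp_def vec_eq_iff, rule allI)
    fix i
    have "norm (z $ i) = 1" using assms by (simp add: torus_def)
    then show "cis (Arg (z $ i)) = z $ i"
      by (metis cis_Arg norm_zero zero_neq_one sgn_div_norm inverse_1 scaleR_one)
  qed
qed

lemma torus_exp_in_torus [simp]: "torus_exp \<theta> \<in> torus"
  by (simp add: torus_exp_def torus_def)

lemma finite_lattice_ball: "finite {n :: int ^ 'k::finite. norm (of_int_vec n) < R}"
proof (rule finite_subset)
  let ?K = "\<lceil>R\<rceil>"
  show "{n :: int ^ 'k. norm (of_int_vec n) < R} \<subseteq> vec_lambda ` (PiE UNIV (\<lambda>_. {- ?K..?K}))"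
  proof
    fix n :: "int ^ 'k"
    assume n: "n \<in> {n. norm (of_int_vec n) < R}"
    have "n $ i \<in> {- ?K..?K}" for i
    proof -
      have "\<bar>real_of_int (n $ i)\<bar> < R"
        using component_le_norm_cart[of "of_int_vec n" i] n by (simp add: of_int_vec_def)
      then show ?thesis by simp linarith
    qed
    then have "vec_nth n \<in> PiE UNIV (\<lambda>_. {- ?K..?K})" by auto
    moreover have "n = vec_lambda (vec_nth n)" by simp
    ultimately show "n \<in> vec_lambda ` (PiE UNIV (\<lambda>_. {- ?K..?K}))" by blast
  qed
  show "finite (vec_lambda ` (PiE UNIV (\<lambda>_. {- ?K..?K})) :: (int ^ 'k) set)"
    by (intro finite_imageI finite_PiE) auto
qed

text \<open>Distinct lattice points are at distance at least 1, so every set of lattice points is closed.\<close>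

lemma open_D_set: "open (D_set :: (real ^ 'k::finite) set)"
proof -
  have "closed (range of_int_vec - {0 :: real ^ 'k})"
  proof (rule discrete_imp_closed[of 1])
    show "\<forall>x\<in>range of_int_vec - {0 :: real ^ 'k}. \<forall>y\<in>range of_int_vec - {0}. dist y x < 1 \<longrightarrow> y = x"
    proof (safe, rule ccontr)
      fix m n :: "int ^ 'k"
      assume "dist (of_int_vec n :: real ^ 'k) (of_int_vec m) < 1" "of_int_vec n \<noteq> (of_int_vec m :: real ^ 'k)"
      then show False
        using norm_of_int_vec_ge_1[of "n - m"] by (auto simp: dist_norm of_int_vec_diff)
    qed
  qed simp
  then show ?thesis unfolding D_set_def Compl_eq_Diff_UNIV[symmetric] by (rule open_Compl)
qed

section \<open>Summation by parts as a convolution\<close>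

text \<open>The coefficients of the group ring element \<open>(1 - z \<delta>)\<^sup>N\<close>, where \<open>\<delta>\<close> is the point mass at the \<open>i\<close>-th
  unit vector. The twist by \<open>z = z\<^sub>i\<close> makes the convolution with a function \<open>a(n) z\<^sup>n\<close> equal to \<open>z\<^sup>n\<close>
  times a backward difference of \<open>a\<close>.\<close>

definition diff_coeff :: "'k::finite \<Rightarrow> nat \<Rightarrow> complex \<Rightarrow> int ^ 'k \<Rightarrow> complex" where
  "diff_coeff i N z \<gamma> = (if \<gamma> \<in> (\<lambda>j. axis i (int j)) ` {..N}
     then (-1) ^ nat (\<gamma> $ i) * of_nat (N choose nat (\<gamma> $ i)) * z ^ nat (\<gamma> $ i) else 0)"

lemma sum_diff_coeff:
  assumes "z \<noteq> 0"
  shows "finite {\<gamma>. diff_coeff i N z \<gamma> \<noteq> 0}"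
    and "(\<Sum>\<gamma> | diff_coeff i N z \<gamma> \<noteq> 0. diff_coeff i N z \<gamma> * h \<gamma>)
      = (\<Sum>j\<le>N. (-1) ^ j * of_nat (N choose j) * z ^ j * h (axis i (int j)))"
proof -
  have supp: "{\<gamma>. diff_coeff i N z \<gamma> \<noteq> 0} = (\<lambda>j. axis i (int j)) ` {..N}"
    using assms by (auto simp: diff_coeff_def axis_nth)
  show "finite {\<gamma>. diff_coeff i N z \<gamma> \<noteq> 0}" by (simp add: supp)
  have "inj_on (\<lambda>j. axis i (int j)) {..N}"
    by (auto simp: inj_on_def axis_eq_axis)
  then show "(\<Sum>\<gamma> | diff_coeff i N z \<gamma> \<noteq> 0. diff_coeff i N z \<gamma> * h \<gamma>)
      = (\<Sum>j\<le>N. (-1) ^ j * of_nat (N choose j) * z ^ j * h (axis i (int j)))"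
    unfolding supp by (subst sum.reindex) (auto simp: diff_coeff_def axis_nth intro!: sum.cong)
qed

lemma sum_diff_coeff_1:
  assumes "z \<noteq> 0"
  shows "(\<Sum>\<gamma> | diff_coeff i N z \<gamma> \<noteq> 0. diff_coeff i N z \<gamma>) = (1 - z) ^ N"
proof -
  have "(1 - z) ^ N = (- z + 1) ^ N" by simp
  also have "\<dots> = (\<Sum>j\<le>N. (-1) ^ j * of_nat (N choose j) * z ^ j)"
    unfolding binomial_ring by (simp add: power_minus[of z] ac_simps)
  finally show ?thesis using sum_diff_coeff(2)[OF assms, of i N "\<lambda>_. 1"] by simp
qed

text \<open>The general term of the series after convolution. It is \<open>z\<^sup>n (\<nabla>\<^sup>N f)(x + n)\<close>, except that
  the term of the original series at the lattice point \<open>0\<close> is left out; this affects only the indices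
  \<open>n = 0, e\<^sub>i, \<dots>, N e\<^sub>i\<close>.\<close>

definition diff_term :: "(real ^ 'k \<Rightarrow> complex) \<Rightarrow> 'k \<Rightarrow> nat \<Rightarrow>
    int ^ 'k \<Rightarrow> (real ^ 'k) \<times> (real ^ 'k::finite) \<Rightarrow> complex" where
  "diff_term f i N n w = cis (of_int_vec n \<bullet> snd w) *
     (\<Sum>j\<le>N. (-1) ^ j * of_nat (N choose j) *
        (if n = axis i (int j) then 0 else f (fst w + of_int_vec (n - axis i (int j)))))"

lemma conv_diff_coeff:
  "conv (diff_coeff i N (cis (\<theta> $ i))) (\<lambda>n. if n \<in> {n. n \<noteq> 0} then F_term f x (torus_exp \<theta>) n else 0) n
   = diff_term f i N n (x, \<theta>)"
proof -
  let ?a = "\<lambda>n. if n \<in> {n. n \<noteq> 0} then F_term f x (torus_exp \<theta>) n else 0"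
  have "conv (diff_coeff i N (cis (\<theta> $ i))) ?a n
      = (\<Sum>j\<le>N. (-1) ^ j * of_nat (N choose j) * cis (\<theta> $ i) ^ j * ?a (n - axis i (int j)))"
    unfolding conv_def by (rule sum_diff_coeff(2)) simp
  also have "\<dots> = diff_term f i N n (x, \<theta>)"
    unfolding diff_term_def sum_distrib_left
  proof (rule sum.cong[OF refl])
    fix j
    have "cis (\<theta> $ i) ^ j * cis (of_int_vec (n - axis i (int j)) \<bullet> \<theta>) = cis (of_int_vec n \<bullet> \<theta>)"
      by (simp add: Complex.DeMoivre cis_mult of_int_vec_diff of_int_vec_axis inner_diff_left
          inner_axis' algebra_simps)
    then show "(-1) ^ j * of_nat (N choose j) * cis (\<theta> $ i) ^ j * ?a (n - axis i (int j))
      = cis (of_int_vec n \<bullet> snd (x, \<theta>)) * ((-1) ^ j * of_nat (N choose j) *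
        (if n = axis i (int j) then 0 else f (fst (x, \<theta>) + of_int_vec (n - axis i (int j)))))"
      by (auto simp: F_term_def torus_power_torus_exp ac_simps)
  qed
  finally show ?thesis .
qed

lemma diff_term_eq_bdiff:
  assumes "real N < \<rho>"  "\<rho> \<le> norm (of_int_vec n)"
  shows "diff_term f i N n w = cis (of_int_vec n \<bullet> snd w) * bdiff (axis i 1) N f (fst w + of_int_vec n)"
proof -
  have "n \<noteq> axis i (int j)" if "j \<le> N" for j
    using assms that by (auto simp: of_int_vec_axis norm_axis_1)
  then show ?thesis
    unfolding diff_term_def bdiff_def
    by (auto intro!: sum.cong simp: of_int_vec_diff of_int_vec_axis algebra_simps)
qed

text \<open>Outside a finite set of indices the convolved series is a tail sum, to which the decay estimates
  apply.\<close>

lemma diff_term_split: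
  fixes f :: "real ^ 'k::finite \<Rightarrow> complex" and i :: 'k
  assumes f: "smooth_homogeneous \<sigma> f" and r: "norm x < r"
    and N: "Re \<sigma> - real N \<le> - 2 * real CARD('k)"
    and \<rho>_def: "\<rho> = r + real N + 1" and p_def: "p = (\<lambda>n. if 2 * \<rho> \<le> norm (of_int_vec n) then 1 else 0)"
  shows "(\<lambda>n. norm (diff_term f i N n (x, \<theta>))) summable_on UNIV" (is ?abs)
    and "(\<Sum>\<^sub>\<infinity>n. diff_term f i N n (x, \<theta>)) = (\<Sum>n | norm (of_int_vec n) < 2 * \<rho>. diff_term f i N n (x, \<theta>))
      + (\<Sum>\<^sub>\<infinity>n. tail_term p (axis i 1) N f n (x, \<theta>))" (is ?eq)
proof -
  let ?B = "{n :: int ^ 'k. norm (of_int_vec n) < 2 * \<rho>}"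
  define T where "T = (\<lambda>n. tail_term p (axis i 1) N f n (x, \<theta>))"
  define H where "H = (\<lambda>n. if n \<in> ?B then diff_term f i N n (x, \<theta>) else 0)"
  have r0: "r > 0" using r norm_ge_zero[of x] by linarith
  then have \<rho>0: "real N < 2 * \<rho>" by (simp add: \<rho>_def)
  have split: "diff_term f i N n (x, \<theta>) = H n + T n" "H n = 0 \<or> T n = 0" for n
    using diff_term_eq_bdiff[OF \<rho>0, of n f i "(x, \<theta>)"]
    by (auto simp: H_def T_def tail_term_def p_def)
  have p: "tail_coeff \<rho> 0 p"
    unfolding tail_coeff_def p_def using r0
    by (intro conjI exI[of _ 1]) (auto simp: \<rho>_def)
  have T: "(\<lambda>n. norm (T n)) summable_on UNIV"
    unfolding T_def
    by (rule tail_term_summable[OF f _ p, where r = r]) (use N r in \<open>auto simp: norm_axis_1 \<rho>_def\<close>)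
  have H: "(H has_sum (\<Sum>n\<in>?B. diff_term f i N n (x, \<theta>))) UNIV"
    using has_sum_finite[OF finite_lattice_ball[of "2 * \<rho>"], of "\<lambda>n. diff_term f i N n (x, \<theta>)"]
    unfolding H_def by (subst has_sum_cong_neutral[where T = ?B]) auto
  have nH: "(\<lambda>n. norm (H n)) summable_on UNIV"
    using summable_on_finite[OF finite_lattice_ball[of "2 * \<rho>"], of "\<lambda>n. norm (diff_term f i N n (x, \<theta>))"]
    unfolding H_def by (subst summable_on_cong_neutral[where T = ?B]) auto
  have "norm (diff_term f i N n (x, \<theta>)) = norm (H n) + norm (T n)" for n
    using split(2)[of n] unfolding split(1)[of n] by (elim disjE) simp_all
  then show ?abs using summable_on_add[OF nH T] by simp
  have "(T has_sum (\<Sum>\<^sub>\<infinity>n. T n)) UNIV"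
    using abs_summable_summable[OF T] by simp
  from has_sum_add[OF H this] have "(\<Sum>\<^sub>\<infinity>n. H n + T n)
      = (\<Sum>n\<in>?B. diff_term f i N n (x, \<theta>)) + (\<Sum>\<^sub>\<infinity>n. T n)"
    by (rule infsumI)
  then show ?eq by (simp only: split(1)[symmetric]) (simp only: T_def)
qed

lemma has_t_sum_F:
  fixes f :: "real ^ 'k::finite \<Rightarrow> complex"
  assumes f: "smooth_homogeneous \<sigma> f" and N: "Re \<sigma> - real N \<le> - 2 * real CARD('k)"
    and i: "cis (\<theta> $ i) \<noteq> 1"
  shows "has_t_sum (\<lambda>n. if n \<in> {n. n \<noteq> 0} then F_term f x (torus_exp \<theta>) n else 0)
    (inverse ((1 - cis (\<theta> $ i)) ^ N) * (\<Sum>\<^sub>\<infinity>n. diff_term f i N n (x, \<theta>)))"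
  unfolding has_t_sum_def
proof (intro exI conjI)
  let ?c = "diff_coeff i N (cis (\<theta> $ i))"
  show "finite {\<gamma>. ?c \<gamma> \<noteq> 0}" by (rule sum_diff_coeff) simp
  have s: "(\<Sum>\<gamma> | ?c \<gamma> \<noteq> 0. ?c \<gamma>) = (1 - cis (\<theta> $ i)) ^ N" by (rule sum_diff_coeff_1) simp
  show "(\<Sum>\<gamma> | ?c \<gamma> \<noteq> 0. ?c \<gamma>) \<noteq> 0" using i s by simp
  show "(\<lambda>n. norm (conv ?c (\<lambda>n. if n \<in> {n. n \<noteq> 0} then F_term f x (torus_exp \<theta>) n else 0) n))
      summable_on UNIV"
    unfolding conv_diff_coeff by (rule diff_term_split(1)[OF f _ N refl refl, of _ "norm x + 1"]) simp
  show "inverse ((1 - cis (\<theta> $ i)) ^ N) * (\<Sum>\<^sub>\<infinity>n. diff_term f i N n (x, \<theta>))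
      = inverse (\<Sum>\<gamma> | ?c \<gamma> \<noteq> 0. ?c \<gamma>) *
        infsum (conv ?c (\<lambda>n. if n \<in> {n. n \<noteq> 0} then F_term f x (torus_exp \<theta>) n else 0)) UNIV"
    unfolding s conv_diff_coeff[abs_def] ..
qed

text \<open>The arguments of \<open>f\<close> that occur are \<open>x + m\<close> with \<open>m \<noteq> 0\<close>, and \<open>D\<close> is exactly the set of \<open>x\<close> for which
  these are all nonzero.\<close>

lemma C_k_on_diff_term:
  assumes f: "smooth_homogeneous \<sigma> f" and S: "open S" "S \<subseteq> D_set \<times> UNIV"
  shows "C_k_on m S (diff_term f i N n)"
  unfolding diff_term_def
proof (intro C_k_on_mult C_k_on_sum C_k_on_const S(1))
  show "C_k_on m S (\<lambda>w. cis (of_int_vec n \<bullet> snd w))"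
    by (intro C_k_on_cis S(1) bounded_linear_inner_right_comp bounded_linear_snd)
  fix j
  show "C_k_on m S (\<lambda>w. if n = axis i (int j) then 0 else f (fst w + of_int_vec (n - axis i (int j))))"
  proof (cases "n = axis i (int j)")
    case True
    then show ?thesis using C_k_on_const[OF S(1)] by simp
  next
    case False
    have ne: "x + of_int_vec (n - axis i (int j)) \<noteq> 0" if "x \<in> D_set" for x
    proof
      assume "x + of_int_vec (n - axis i (int j)) = 0"
      then have x: "x = of_int_vec (axis i (int j) - n)"
        by (simp add: of_int_vec_diff algebra_simps add_eq_0_iff)
      moreover have "x \<noteq> 0"
        using norm_of_int_vec_ge_1[of "axis i (int j) - n"] False x by auto
      ultimately show False using that unfolding D_set_def by auto
    qed
    have "C_k_on m S (\<lambda>w. f (fst w + of_int_vec (n - axis i (int j))))"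
    proof (rule C_k_on_compose_affine[where T = "UNIV - {0}", OF S(1) bounded_linear_fst])
      show "fst w + of_int_vec (n - axis i (int j)) \<in> UNIV - {0}" if "w \<in> S" for w
        using that S(2) ne by auto
      show "C_k_on m (UNIV - {0}) f"
        using f unfolding smooth_homogeneous_def smooth_on_def by blast
    qed
    then show ?thesis using False by simp
  qed
qed

text \<open>Near a point where \<open>z\<^sub>i \<noteq> 1\<close> the sum is \<open>(1 - z\<^sub>i)\<^sup>-\<^sup>N\<close> times the sum of finitely many smooth functions
  and a tail sum. The number \<open>N\<close> of differences may depend on the required order \<open>m\<close> of
  differentiability, because the value of a t-sum does not depend on the convolving function.\<close>

theorem theorem1p1:
  fixes f :: "real ^ 'k::finite \<Rightarrow> complex" and s :: complex and \<epsilon> :: int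
  assumes "\<epsilon> \<in> {1, -1}"
    and "smooth_on (UNIV - {0}) f"
    and "homogeneous_of_type (- s) \<epsilon> f"
  shows "(\<forall>x\<in>D_set. \<forall>z\<in>torus - {1}. t_summable_on (F_term f x z) {n. n \<noteq> 0}) \<and>
    smooth_on_Rk_torus (D_set \<times> (torus - {1})) (F_sum f)"
proof -
  have f: "smooth_homogeneous (- s) f"
    using assms(2,3) unfolding smooth_homogeneous_def homogeneous_of_type_def by blast
  have large: "\<exists>N. Re (- s) - real N + real m + 1 \<le> - 2 * real CARD('k)" for m
    using real_arch_simple[of "Re (- s) + real m + 1 + 2 * real CARD('k)"]
    by (auto simp: algebra_simps)
  have nontriv: "\<exists>i. cis (\<theta> $ i) \<noteq> 1" if "torus_exp \<theta> \<noteq> 1" for \<theta> :: "real ^ 'k"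
    using that by (auto simp: torus_exp_def vec_eq_iff)
  have "t_summable_on (F_term f x z) {n. n \<noteq> 0}" if z: "z \<in> torus - {1}" for x z
  proof -
    obtain \<theta> where \<theta>: "torus_exp \<theta> = z" using torus_exp_surj z by blast
    then obtain i where i: "cis (\<theta> $ i) \<noteq> 1" using nontriv z by blast
    obtain N where "Re (- s) - real N + real 0 + 1 \<le> - 2 * real CARD('k)" using large by blast
    then have "Re (- s) - real N \<le> - 2 * real CARD('k)" by simp
    from has_t_sum_F[OF f this i, of x] show ?thesis
      unfolding \<theta> t_summable_on_def t_summable_def has_t_sum_def by blast
  qed
  moreover have "smooth_on_Rk_torus (D_set \<times> (torus - {1})) (F_sum f)"
  proof -
    let ?S = "{(x, \<theta>). (x, torus_exp \<theta>) \<in> D_set \<times> (torus - {1})} :: ((real ^ 'k) \<times> (real ^ 'k)) set"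
    let ?F = "\<lambda>(x, \<theta>). F_sum f x (torus_exp \<theta>)"
    have loc: "\<exists>T. open T \<and> w \<in> T \<and> T \<subseteq> ?S \<and> C_k_on m T ?F" if w: "w \<in> ?S" for w m
    proof -
      obtain i where i: "cis (snd w $ i) \<noteq> 1" using nontriv[of "snd w"] w by auto
      obtain N where N: "Re (- s) - real N + real m + 1 \<le> - 2 * real CARD('k)"
        using large by blast
      define r where "r = norm (fst w) + 1"
      define \<rho> where "\<rho> = r + real N + 1"
      define p :: "int ^ 'k \<Rightarrow> complex" where
        "p = (\<lambda>n. if 2 * \<rho> \<le> norm (of_int_vec n) then 1 else 0)"
      define T where "T = ((D_set \<inter> ball 0 r) \<times> UNIV) \<inter> {w :: (real ^ 'k) \<times> (real ^ 'k). cis (snd w $ i) \<noteq> 1}"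
      have T: "open T" unfolding T_def
        by (intro open_Int open_Times open_D_set open_ball open_UNIV open_Collect_neq continuous_intros)
      have F: "?F w = inverse ((1 - cis (snd w $ i)) ^ N) *
          ((\<Sum>n | norm (of_int_vec n) < 2 * \<rho>. diff_term f i N n w)
           + (\<Sum>\<^sub>\<infinity>n. tail_term p (axis i 1) N f n w))" if "w \<in> T" for w
      proof -
        obtain x \<theta> where w: "w = (x, \<theta>)" by (cases w)
        have x: "norm x < r" and \<theta>: "cis (\<theta> $ i) \<noteq> 1" using that by (auto simp: w T_def)
        have N': "Re (- s) - real N \<le> - 2 * real CARD('k)" using N by simp
        from t_sum_eqI[OF has_t_sum_F[OF f N' \<theta>, of x]] show ?thesis
          unfolding w diff_term_split(2)[OF f x N' \<rho>_def p_def] by (simp add: F_sum_def t_sum_on_def)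
      qed
      have "0 < \<rho>" using norm_ge_zero[of "fst w"] unfolding \<rho>_def r_def by linarith
      then have p: "tail_coeff \<rho> 0 p"
        unfolding tail_coeff_def p_def by (intro conjI exI[of _ 1]) auto
      have "C_k_on m T (\<lambda>w. inverse ((1 - cis (snd w $ i)) ^ N) *
          ((\<Sum>n | norm (of_int_vec n) < 2 * \<rho>. diff_term f i N n w)
           + (\<Sum>\<^sub>\<infinity>n. tail_term p (axis i 1) N f n w)))"
      proof (intro C_k_on_mult C_k_on_add C_k_on_sum C_k_on_inverse C_k_on_power T)
        have "C_k_on m T (\<lambda>w. 1 + (- 1) * cis (snd w $ i))"
          by (intro C_k_on_add C_k_on_mult C_k_on_const C_k_on_cis T
              bounded_linear_compose[OF bounded_linear_vec_nth bounded_linear_snd])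
        then show "C_k_on m T (\<lambda>w. 1 - cis (snd w $ i))" by simp
        show "C_k_on m T (diff_term f i N n)" for n
          by (rule C_k_on_diff_term[OF f T]) (auto simp: T_def)
        have "C_k_on m (ball 0 r \<times> UNIV) (\<lambda>w. \<Sum>\<^sub>\<infinity>n. tail_term p (axis i 1) N f n w)"
          by (rule tail_sum_C_k_on[OF f _ p]) (use N in \<open>auto simp: \<rho>_def norm_axis_1\<close>)
        then show "C_k_on m T (\<lambda>w. \<Sum>\<^sub>\<infinity>n. tail_term p (axis i 1) N f n w)"
          by (rule C_k_on_subset) (auto simp: T_def)
        show "(1 - cis (snd w $ i)) ^ N \<noteq> 0" if "w \<in> T" for w
          using that by (simp add: T_def)
      qed
      then have "C_k_on m T ?F"
        by (rule C_k_on_cong[OF T, rotated]) (use F in simp)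
      moreover have "w \<in> T" using w i by (auto simp: T_def r_def)
      moreover have "T \<subseteq> ?S"
      proof
        fix v assume v: "v \<in> T"
        then have "torus_exp (snd v) $ i \<noteq> 1 $ i" by (simp add: T_def torus_exp_def)
        then have "torus_exp (snd v) \<noteq> 1" by metis
        then show "v \<in> ?S" using v by (auto simp: T_def)
      qed
      ultimately show ?thesis using T by blast
    qed
    have "open ?S" using loc by (subst open_subopen) meson
    moreover have "C_k_on m ?S ?F" for m
      by (rule C_k_on_local) (use loc in meson)
    ultimately show ?thesis unfolding smooth_on_Rk_torus_def smooth_on_def by blast
  qed
  ultimately show ?thesis by blast
qed

end
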